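(* Let $f$ and $g$ be functions such that either (0-case) $f\in\mathcal{F}$ and $g\in\mathcal{F}_0$, or (1-case) $f\in\mathbb{K}[x^{-1},x]$ and $g\in\mathcal{F}_1$, so that $f\circ g\in\mathcal{F}$. Then for every $h\in\mathcal{F}$: $h=f\circ g$ if and only if $\Phi_n(h)=\Phi_n(f)\circ\Phi_{\bullet}(g)$ for all $n\ge0$; that is, $\Phi_n(h)=\Phi_n(f)(\Phi_1(g),\ldots,\Phi_n(g))$ in the 0-case and $\Phi_n(h)=\Phi_n(f)(\Phi_0(g),\Phi_1(g),\ldots,\Phi_n(g))$ in the 1-case.
   Context: $\mathbb{K}$ is a field of characteristic zero, $\mathcal{F}=\mathbb{K}[[x]]$ with derivation $D$ (extended to Laurent polynomials $\mathbb{K}[x^{-1},x]$), $\mathcal{F}_0$ the series with zero constant term, $\mathcal{F}_1$ those with nonzero constant term; composition $f\circ g=\sum_n([x^n]f)g^n$. Partial Bell polynomials: $B_{0,0}=1$, $B_{n,0}=0$ ($n\ge1$), $B_{n,k}=0$ ($k>n$), and for $1\le k\le n$, $B_{n,k}=\sum\frac{n!}{\prod_ir_i!(i!)^{r_i}}\prod_iX_i^{r_i}$ over non-negative integers with $\sum r_i=k$, $\sum ir_i=n$. Faà di Bruno polynomials: for a power series $u\in\mathcal{F}$, $\Phi_n(u):=\sum_{k=0}^nD^k(u)(0)B_{n,k}$ (so $\Phi_0(u)=u(0)$); for a Laurent polynomial $f$ in the 1-case, $\Phi_n(f):=\sum_{k=0}^nD^k(f)(X_0)B_{n,k}$, a polynomial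 in $X_0^{\pm1},X_1,\ldots,X_n$. $P(H_0,H_1,\ldots)$ denotes substituting $H_j$ for $X_j$. *)

theory Defs
  imports
    "HOL-Computational_Algebra.Formal_Laurent_Series"
    "HOL-Library.Poly_Mapping"
    "HOL-Library.FuncSet"
begin

text \<open>
  Laurent polynomials in the indeterminates \<open>X\<^sub>0, X\<^sub>1, X\<^sub>2, \<dots>\<close>: finitely supported coefficient
  functions on exponent vectors, multiplied by convolution. This common ambient ring contains both
  the polynomial ring in \<open>X\<^sub>1, X\<^sub>2, \<dots>\<close> and the ring of polynomials in
  \<open>X\<^sub>0, X\<^sub>0\<inverse>, X\<^sub>1, X\<^sub>2, \<dots>\<close>.
\<close>

type_synonym 'a lpoly = "(nat \<Rightarrow>\<^sub>0 int) \<Rightarrow>\<^sub>0 'a"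

definition Cst :: "'a::zero \<Rightarrow> 'a lpoly" where
  "Cst c = Poly_Mapping.single 0 c"

definition X_pow :: "nat \<Rightarrow> int \<Rightarrow> 'a::{zero,one} lpoly" where
  "X_pow i e = Poly_Mapping.single (Poly_Mapping.single i e) 1"

abbreviation X :: "nat \<Rightarrow> 'a::{zero,one} lpoly" where
  "X i \<equiv> X_pow i 1"

text \<open>Integer powers in a commutative ring; for negative exponents, meaningful for units only.\<close>

definition unit_inverse :: "'a::comm_ring_1 \<Rightarrow> 'a" where
  "unit_inverse a = (THE b. a * b = 1)"

definition unit_powi :: "'a::comm_ring_1 \<Rightarrow> int \<Rightarrow> 'a" where
  "unit_powi a e = (if 0 \<le> e then a ^ nat e else unit_inverse a ^ nat (- e))"

definition subst :: "'a::comm_ring_1 lpoly \<Rightarrow> (nat \<Rightarrow> 'a lpoly) \<Rightarrow> 'a lpoly" where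
  "subst P H = (\<Sum>m\<in>Poly_Mapping.keys P. Cst (Poly_Mapping.lookup P m) *
     (\<Prod>i\<in>Poly_Mapping.keys m. unit_powi (H i) (Poly_Mapping.lookup m i)))"

definition bell_index :: "nat \<Rightarrow> nat \<Rightarrow> (nat \<Rightarrow> nat) set" where
  "bell_index n k = {r \<in> {1..n} \<rightarrow>\<^sub>E UNIV. (\<Sum>i=1..n. r i) = k \<and> (\<Sum>i=1..n. i * r i) = n}"

definition bell :: "nat \<Rightarrow> nat \<Rightarrow> 'a::field_char_0 lpoly" where
  "bell n k =
     (if k = 0 then (if n = 0 then 1 else 0)
      else if k > n then 0
      else (\<Sum>r\<in>bell_index n k.
              Cst (fact n / (\<Prod>i=1..n. fact (r i) * fact i ^ r i)) * (\<Prod>i=1..n. X i ^ r i)))"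

definition Phi :: "nat \<Rightarrow> 'a::field_char_0 fps \<Rightarrow> 'a lpoly" where
  "Phi n u = (\<Sum>k=0..n. Cst (fps_nth ((fps_deriv ^^ k) u) 0) * bell n k)"

definition laurent_polys :: "'a::zero fls set" where
  "laurent_polys = {f. finite {i. fls_nth f i \<noteq> 0}}"

definition eval_X0 :: "'a::comm_ring_1 fls \<Rightarrow> 'a lpoly" where
  "eval_X0 f = (\<Sum>i | fls_nth f i \<noteq> 0. Cst (fls_nth f i) * X_pow 0 i)"

definition Phi_laurent :: "nat \<Rightarrow> 'a::field_char_0 fls \<Rightarrow> 'a lpoly" where
  "Phi_laurent n f = (\<Sum>k=0..n. eval_X0 ((fls_deriv ^^ k) f) * bell n k)"

text \<open>
  The library's \<open>fls_compose_fps\<close> and \<open>fps_compose\<close> are only meaningful when the inner series has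
  zero constant term, hence a separate composition for Laurent polynomials with inner series of
  nonzero constant term.
\<close>

definition laurent_compose :: "'a::field fls \<Rightarrow> 'a fps \<Rightarrow> 'a fps" where
  "laurent_compose f g = (\<Sum>i | fls_nth f i \<noteq> 0. fps_const (fls_nth f i) * g powi i)"

end

theory Submission
  imports Defs
begin

text \<open>
  Let \<open>X(t) = \<Sum>\<^sub>n\<^sub>\<ge>\<^sub>1 X\<^sub>n t\<^sup>n/n!\<close>. By the multinomial theorem \<open>X(t)\<^sup>k/k! = \<Sum>\<^sub>n B\<^sub>n\<^sub>,\<^sub>k t\<^sup>n/n!\<close>, so
  \<open>\<Sum>\<^sub>n \<Phi>\<^sub>n(u) t\<^sup>n/n! = u \<circ> X(t)\<close>, and substituting \<open>H\<^sub>j\<close> for \<open>X\<^sub>j\<close> merely replaces \<open>X(t)\<close> by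
  \<open>\<Sum>\<^sub>n\<^sub>\<ge>\<^sub>1 H\<^sub>n t\<^sup>n/n!\<close>. In the 0-case, \<open>\<Phi>\<^sub>n(f) \<circ> \<Phi>(g) = \<Phi>\<^sub>n(f \<circ> g)\<close> is then the associativity
  \<open>f \<circ> (g \<circ> X) = (f \<circ> g) \<circ> X\<close>, and \<open>u\<close> is determined by \<open>u \<circ> X\<close> because \<open>X(t)\<close> has nonzero linear
  coefficient over a domain. The 1-case reduces to the 0-case: replace \<open>f\<close> by its Taylor series
  at \<open>g(0)\<close> and \<open>g\<close> by \<open>g - g(0)\<close>.
\<close>

section \<open>Constants and substitution\<close>

lemma Cst_0 [simp]: "Cst 0 = 0"
  by (simp add: Cst_def)

lemma Cst_1 [simp]: "Cst 1 = 1"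
  by (simp add: Cst_def)

lemma Cst_add: "Cst (a + b) = Cst a + Cst b"
  by (simp add: Cst_def single_add)

lemma Cst_mult: "Cst (a * b) = Cst a * Cst b"
  by (simp add: Cst_def mult_single)

lemma Cst_sum: "Cst (sum f A) = (\<Sum>i\<in>A. Cst (f i))"
  by (induction A rule: infinite_finite_induct) (auto simp: Cst_add)

lemma Cst_prod: "Cst (prod f A) = (\<Prod>i\<in>A. Cst (f i))"
  by (induction A rule: infinite_finite_induct) (auto simp: Cst_mult)

lemma Cst_power: "Cst (a ^ n) = Cst a ^ n"
  by (induction n) (auto simp: Cst_mult)

lemma Cst_of_nat: "Cst (of_nat n) = of_nat n"
  by (induction n) (auto simp: Cst_add)

lemma Cst_eq_iff [simp]: "Cst a = Cst b \<longleftrightarrow> a = b"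
  unfolding Cst_def by (metis lookup_single_eq)

lemma X_pow_0_right [simp]: "X_pow i 0 = 1"
  by (simp add: X_pow_def)

lemma X_power: "(X i :: 'a::comm_semiring_1 lpoly) ^ n = X_pow i (int n)"
proof (induction n)
  case (Suc n)
  then show ?case
    by (simp add: X_pow_def mult_single flip: single_add)
qed simp

lemma X_neq_0: "X i \<noteq> (0 :: 'a::zero_neq_one lpoly)"
  unfolding X_pow_def by (metis lookup_single_eq lookup_zero zero_neq_one)

lemma prod_X_pow:
  assumes "finite A"
  shows "(\<Prod>i\<in>A. X_pow i (e i) :: 'a::comm_semiring_1 lpoly) =
    Poly_Mapping.single (\<Sum>i\<in>A. Poly_Mapping.single i (e i)) 1"
  using assms by (induction A) (auto simp: X_pow_def mult_single)

lemma lookup_sum_single: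
  assumes "finite A"
  shows "Poly_Mapping.lookup (\<Sum>i\<in>A. Poly_Mapping.single i (e i)) j = (if j \<in> A then e j else 0)"
  using assms by (induction A) (auto simp: lookup_add lookup_single when_def)

lemma unit_powi_0_right [simp]: "unit_powi a 0 = 1"
  by (simp add: unit_powi_def)

lemma unit_powi_of_nat [simp]: "unit_powi a (int n) = a ^ n"
  by (simp add: unit_powi_def)

lemma unit_inverse_unique:
  assumes "a * b = 1"
  shows "unit_inverse a = b"
  unfolding unit_inverse_def
proof (rule the_equality)
  show "a * b = 1"
    by (fact assms)
next
  fix c assume "a * c = 1"
  with assms show "c = b"
    by (metis mult.assoc mult.commute mult_1)
qed

text \<open>In the 1-case \<open>X 0\<close> is replaced by the nonzero constant
  \<open>g(0)\<close>; such a constant is a unit, so negative exponents get their usual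
  meaning.\<close>

lemma unit_powi_Cst:
  fixes a :: "'a::field"
  assumes "a \<noteq> 0"
  shows "unit_powi (Cst a) i = Cst (a powi i)"
proof -
  have "unit_inverse (Cst a) = Cst (inverse a)"
    by (rule unit_inverse_unique) (use assms in \<open>simp flip: Cst_mult\<close>)
  then show ?thesis
    by (simp add: unit_powi_def power_int_def Cst_power)
qed

lemma subst_superset:
  assumes "finite A" "Poly_Mapping.keys P \<subseteq> A"
  shows "subst P H = (\<Sum>m\<in>A. Cst (Poly_Mapping.lookup P m) *
     (\<Prod>i\<in>Poly_Mapping.keys m. unit_powi (H i) (Poly_Mapping.lookup m i)))"
  unfolding subst_def
  by (rule sum.mono_neutral_left) (use assms in \<open>auto simp: in_keys_iff\<close>)

lemma subst_0 [simp]: "subst 0 H = 0"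
  by (simp add: subst_def)

lemma subst_add: "subst (P + Q) H = subst P H + subst Q H"
proof -
  let ?A = "Poly_Mapping.keys P \<union> Poly_Mapping.keys Q"
  have "Poly_Mapping.keys (P + Q) \<subseteq> ?A"
    by (rule Poly_Mapping.keys_add)
  then show ?thesis
    by (simp add: subst_superset[where A = ?A] lookup_add Cst_add distrib_right sum.distrib)
qed

lemma subst_sum: "subst (sum P A) H = (\<Sum>i\<in>A. subst (P i) H)"
  by (induction A rule: infinite_finite_induct) (auto simp: subst_add)

text \<open>Faa di Bruno polynomials are sums of such monomials, so together with additivity this
  computes \<open>subst\<close> on them. Only \<open>X 0\<close> may carry a negative
  exponent.\<close>

lemma subst_monomial:
  fixes c :: "'a::comm_ring_1"
  shows "subst (Cst c * X_pow 0 e * (\<Prod>i=1..n. X i ^ r i)) H =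
    Cst c * unit_powi (H 0) e * (\<Prod>i=1..n. H i ^ r i)"
proof -
  define d where "d i = (if i = 0 then e else int (r i))" for i
  define m where "m = (\<Sum>i=0..n. Poly_Mapping.single i (d i))"
  have lookup_m: "Poly_Mapping.lookup m i = (if i \<le> n then d i else 0)" for i
    by (simp add: m_def lookup_sum_single)
  have split: "(\<Prod>i=0..n. F i) = F 0 * (\<Prod>i=1..n. F i)" for F :: "nat \<Rightarrow> 'a lpoly"
    by (simp add: prod.atLeast_Suc_atMost)
  have "X_pow 0 e * (\<Prod>i=1..n. X i ^ r i) = (\<Prod>i=0..n. X_pow i (d i) :: 'a lpoly)"
    by (simp add: split d_def X_power)
  then have "Cst c * X_pow 0 e * (\<Prod>i=1..n. X i ^ r i) = Poly_Mapping.single m c"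
    by (simp add: prod_X_pow m_def Cst_def mult_single mult.assoc)
  also have "subst \<dots> H =
      Cst c * (\<Prod>i\<in>Poly_Mapping.keys m. unit_powi (H i) (Poly_Mapping.lookup m i))"
    by (subst subst_superset[where A = "{m}"]) (auto simp: lookup_single)
  \<comment> \<open>Indices up to \<open>n\<close> outside \<open>keys m\<close> have exponent 0 and
    contribute the factor 1.\<close>
  also have "(\<Prod>i\<in>Poly_Mapping.keys m. unit_powi (H i) (Poly_Mapping.lookup m i)) =
      (\<Prod>i=0..n. unit_powi (H i) (d i))"
    by (rule prod.mono_neutral_cong_left)
       (auto simp: in_keys_iff lookup_m split: if_splits)
  also have "\<dots> = unit_powi (H 0) e * (\<Prod>i=1..n. H i ^ r i)"
    by (simp add: split d_def)
  finally show ?thesis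
    by (simp add: mult.assoc)
qed

section \<open>The multinomial theorem and Bell polynomials\<close>

lemma finite_multinomial_index:
  assumes "finite I"
  shows "finite {r \<in> I \<rightarrow>\<^sub>E (UNIV :: nat set). sum r I = k}"
proof (rule finite_subset)
  show "{r \<in> I \<rightarrow>\<^sub>E UNIV. sum r I = k} \<subseteq> I \<rightarrow>\<^sub>E {..k}"
    using assms by (auto simp: PiE_iff dest: extensional_arb intro: member_le_sum)
qed (use assms in \<open>auto intro: finite_PiE\<close>)

text \<open>\<open>c m\<close> stands for \<open>1/m!\<close> in a ring that need not have division;
  each multinomial coefficient then splits into factors. The induction peels off the exponent of one
  variable by the binomial theorem.\<close>

lemma multinomial_theorem:
  fixes y :: "'i \<Rightarrow> 'b::comm_ring_1"
  assumes "finite I" and c: "\<And>m. of_nat (fact m) * c m = (1::'b)"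
  shows "c k * (\<Sum>i\<in>I. y i) ^ k =
    (\<Sum>r | r \<in> I \<rightarrow>\<^sub>E UNIV \<and> sum r I = k. \<Prod>i\<in>I. c (r i) * y i ^ r i)"
  using assms(1)
proof (induction I arbitrary: k)
  case empty
  show ?case
    using c[of 0] by (cases k) auto
next
  case (insert a I)
  have c_binomial: "c k * of_nat (k choose j) = c j * c (k - j)" if "j \<le> k" for j
  proof -
    have "of_nat (fact k) = (of_nat (fact j) * of_nat (fact (k - j)) * of_nat (k choose j) :: 'b)"
      using that by (metis binomial_fact_lemma of_nat_mult)
    then have "c j * c (k - j) * (of_nat (fact k) * c k) =
        (of_nat (fact j) * c j) * (of_nat (fact (k - j)) * c (k - j)) * (c k * of_nat (k choose j))"
      by (simp add: mult_ac)
    then show ?thesis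
      by (simp add: c)
  qed
  let ?R = "\<lambda>I k. {r. r \<in> I \<rightarrow>\<^sub>E (UNIV :: nat set) \<and> sum r I = k}"
  let ?t = "\<lambda>I r. \<Prod>i\<in>I. c (r i) * y i ^ r i"
  have "c k * (\<Sum>i\<in>insert a I. y i) ^ k =
      (\<Sum>j\<le>k. (c k * of_nat (k choose j)) * y a ^ j * (\<Sum>i\<in>I. y i) ^ (k - j))"
    using insert.hyps by (simp add: binomial_ring sum_distrib_left mult.assoc)
  also have "\<dots> = (\<Sum>j\<le>k. c j * y a ^ j * (c (k - j) * (\<Sum>i\<in>I. y i) ^ (k - j)))"
    by (rule sum.cong) (simp_all add: c_binomial mult_ac)
  also have "\<dots> = (\<Sum>j\<le>k. \<Sum>r\<in>?R I (k - j). c j * y a ^ j * ?t I r)"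
    by (simp add: insert.IH sum_distrib_left)
  also have "\<dots> = (\<Sum>(j, r)\<in>Sigma {..k} (\<lambda>j. ?R I (k - j)). c j * y a ^ j * ?t I r)"
    using finite_multinomial_index[OF insert.hyps(1)] by (subst sum.Sigma) auto
  also have "\<dots> = (\<Sum>r\<in>?R (insert a I) k. ?t (insert a I) r)"
  \<comment> \<open>An exponent function on \<open>insert a I\<close> corresponds to its value
    \<open>j\<close> at \<open>a\<close> and its restriction to \<open>I\<close>; the value
    \<open>undefined\<close> at \<open>a\<close> keeps the restriction extensional.\<close>
  proof (rule sum.reindex_bij_witness[where i = "\<lambda>r. (r a, r(a := undefined))"
        and j = "\<lambda>(j, r). r(a := j)"], goal_cases)
    case (1 p)
    then show ?case
      using insert.hyps by (auto simp: PiE_iff extensional_def fun_eq_iff)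
  next
    case (2 p)
    obtain j r where p: "p = (j, r)"
      by (cases p)
    have "sum (r(a := j)) I = sum r I"
      using insert.hyps by (intro sum.cong) auto
    with 2 show ?case
      using insert.hyps by (auto simp: p PiE_iff extensional_def)
  next
    case (3 r)
    show ?case
      by simp
  next
    case (4 r)
    have "sum (r(a := undefined)) I = sum r I"
      using insert.hyps by (intro sum.cong) auto
    with 4 show ?case
      using insert.hyps by (auto simp: PiE_iff extensional_def)
  next
    case (5 p)
    have "?t I ((snd p)(a := fst p)) = ?t I (snd p)"
      using insert.hyps by (intro prod.cong) auto
    then show ?case
      using insert.hyps by (auto simp: case_prod_unfold)
  qed
  finally show ?case .
qed

definition bell_at :: "nat \<Rightarrow> nat \<Rightarrow> (nat \<Rightarrow> 'a::field_char_0 lpoly) \<Rightarrow> 'a lpoly" where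
  "bell_at n k H = (\<Sum>r\<in>bell_index n k.
     Cst (fact n / (\<Prod>i=1..n. fact (r i) * fact i ^ r i)) * (\<Prod>i=1..n. H i ^ r i))"

text \<open>The boundary cases of \<open>bell\<close> fit the general sum:
  \<open>\<Sum> r i \<le> \<Sum> i * r i\<close> leaves no index for \<open>k > n\<close>, while
  \<open>k = 0\<close> makes every \<open>r i\<close> vanish and so forces
  \<open>n = 0\<close>.\<close>

lemma bell_eq_bell_at: "bell n k = bell_at n k X"
proof -
  have "bell_index n k = {}" if "k > n"
  proof (rule ccontr)
    assume "bell_index n k \<noteq> {}"
    then obtain r where r: "(\<Sum>i=1..n. r i) = k" "(\<Sum>i=1..n. i * r i) = n"
      by (auto simp: bell_index_def)
    have "(\<Sum>i=1..n. r i) \<le> (\<Sum>i=1..n. i * r i)"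
      by (rule sum_mono) auto
    with r that show False
      by simp
  qed
  moreover have "bell_index n 0 = (if n = 0 then {\<lambda>_. undefined} else {})"
    by (auto simp: bell_index_def)
  ultimately show ?thesis
    by (auto simp: bell_def bell_at_def)
qed

lemma bell_at_cong:
  assumes "\<And>i. 1 \<le> i \<Longrightarrow> H i = G i"
  shows "bell_at n k H = bell_at n k G"
  unfolding bell_at_def using assms by (intro sum.cong arg_cong2[where f = "(*)"] prod.cong) auto

lemma subst_X0_bell:
  "subst (Cst c * X_pow 0 e * bell n k) H = Cst c * unit_powi (H 0) e * bell_at n k H"
proof -
  have "Cst c * X_pow 0 e * bell n k = (\<Sum>r\<in>bell_index n k.
      Cst (c * (fact n / (\<Prod>i=1..n. fact (r i) * fact i ^ r i))) * X_pow 0 e * (\<Prod>i=1..n. X i ^ r i))"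
    unfolding bell_eq_bell_at bell_at_def sum_distrib_left Cst_mult by (simp only: mult_ac)
  then have "subst (Cst c * X_pow 0 e * bell n k) H = (\<Sum>r\<in>bell_index n k.
      Cst (c * (fact n / (\<Prod>i=1..n. fact (r i) * fact i ^ r i))) * unit_powi (H 0) e *
        (\<Prod>i=1..n. H i ^ r i))"
    by (simp only: subst_sum subst_monomial)
  then show ?thesis
    unfolding bell_at_def sum_distrib_left Cst_mult by (simp only: mult_ac)
qed

lemma subst_bell: "subst (Cst c * bell n k) H = Cst c * bell_at n k H"
  using subst_X0_bell[of c 0 n k H] by simp

text \<open>The constant coefficient ignores \<open>H 0\<close>, so that this series can be composed with.\<close>

definition egf :: "(nat \<Rightarrow> 'a::field_char_0 lpoly) \<Rightarrow> 'a lpoly fps" where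
  "egf H = Abs_fps (\<lambda>n. if n = 0 then 0 else Cst (1 / fact n) * H n)"

text \<open>Allows \<open>egf H\<close> to be cut off at degree \<open>n\<close>, so that the finite
  multinomial theorem applies.\<close>

lemma fps_power_nth_cong:
  assumes "\<And>i. i \<le> n \<Longrightarrow> fps_nth a i = fps_nth b i"
  shows "fps_nth (a ^ k) n = fps_nth (b ^ k) n"
  using assms
proof (induction k arbitrary: n)
  case (Suc k)
  then show ?case
    by (auto simp: fps_mult_nth intro!: sum.cong arg_cong2[where f = "(*)"])
qed simp

lemma prod_fps_const:
  fixes a :: "'i \<Rightarrow> 'b::comm_ring_1"
  shows "(\<Prod>i\<in>A. fps_const (a i)) = fps_const (\<Prod>i\<in>A. a i)"
  by (induction A rule: infinite_finite_induct) auto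

lemma egf_power_nth:
  "Cst (1 / fact k) * fps_nth (egf H ^ k) n = Cst (1 / fact n) * bell_at n k H"
proof -
  \<comment> \<open>\<open>c m\<close> is \<open>1/m!\<close>, \<open>y i\<close> is the degree
    \<open>i\<close> term of \<open>egf H\<close>, and \<open>w r\<close> is the coefficient that
    \<open>r\<close> contributes to the expansion.\<close>
  define c :: "nat \<Rightarrow> 'a lpoly fps" where "c m = fps_const (Cst (1 / fact m))" for m
  define y where "y i = fps_const (Cst (1 / fact i) * H i) * fps_X ^ i" for i
  define w where "w r = Cst (\<Prod>i=1..n. 1 / (fact (r i) * fact i ^ r i)) * (\<Prod>i=1..n. H i ^ r i)" for r
  have c: "of_nat (fact m) * c m = 1" for m
  proof -
    have "(of_nat (fact m) :: 'a lpoly fps) = fps_const (Cst (fact m))"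
      by (metis Cst_of_nat fps_of_nat of_nat_fact)
    then show ?thesis
      by (simp add: c_def flip: Cst_mult)
  qed
  have summand: "(\<Prod>i=1..n. c (r i) * y i ^ r i) = fps_const (w r) * fps_X ^ (\<Sum>i=1..n. i * r i)" for r
  proof -
    have "c (r i) * y i ^ r i =
        fps_const (Cst (1 / (fact (r i) * fact i ^ r i)) * H i ^ r i) * fps_X ^ (i * r i)" for i
    proof -
      have "Cst (1 / (fact (r i) * fact i ^ r i) :: 'a) = Cst (1 / fact (r i)) * Cst (1 / fact i) ^ r i"
        by (simp add: power_one_over flip: Cst_mult Cst_power)
      then show ?thesis
        by (simp add: c_def y_def power_mult_distrib mult.assoc[symmetric] flip: power_mult)
    qed
    then show ?thesis
      by (simp add: w_def prod.distrib power_sum Cst_prod prod_fps_const)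
  qed
  have "fps_nth (egf H ^ k) n = fps_nth ((\<Sum>i=1..n. y i) ^ k) n"
    by (rule fps_power_nth_cong) (auto simp: egf_def y_def fps_sum_nth if_distrib cong: if_cong)
  then have "Cst (1 / fact k) * fps_nth (egf H ^ k) n = fps_nth (c k * (\<Sum>i=1..n. y i) ^ k) n"
    by (simp add: c_def)
  also have "\<dots> = (\<Sum>r | r \<in> {1..n} \<rightarrow>\<^sub>E UNIV \<and> sum r {1..n} = k.
      if (\<Sum>i=1..n. i * r i) = n then w r else 0)"
    unfolding multinomial_theorem[OF finite_atLeastAtMost c] summand
    by (auto simp: fps_sum_nth intro!: sum.cong)
  \<comment> \<open>The expansion supplies the condition on \<open>\<Sum> r i\<close>, the power of
    \<open>fps_X\<close> the one on \<open>\<Sum> i * r i\<close>; together they cut out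
    \<open>bell_index\<close>.\<close>
  also have "\<dots> = (\<Sum>r\<in>bell_index n k. w r)"
  proof -
    have "{r \<in> {1..n} \<rightarrow>\<^sub>E UNIV. sum r {1..n} = k} \<inter> {r. (\<Sum>i=1..n. i * r i) = n} = bell_index n k"
      by (auto simp: bell_index_def)
    then show ?thesis
      by (simp add: sum.If_cases finite_multinomial_index)
  qed
  also have "\<dots> = Cst (1 / fact n) * bell_at n k H"
    unfolding bell_at_def sum_distrib_left
    by (rule sum.cong) (simp_all add: w_def prod_dividef mult.assoc[symmetric] flip: Cst_mult)
  finally show ?thesis .
qed

section \<open>Generating functions of the Faa di Bruno polynomials\<close>

text \<open>Moves series over the field to the coefficient ring of \<open>egf H\<close>, where the
  two can be composed.\<close>

definition fps_Cst :: "'a::zero fps \<Rightarrow> 'a lpoly fps" where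
  "fps_Cst u = Abs_fps (\<lambda>n. Cst (fps_nth u n))"

lemma fps_Cst_nth [simp]: "fps_nth (fps_Cst u) n = Cst (fps_nth u n)"
  by (simp add: fps_Cst_def)

lemma fps_Cst_eq_iff: "fps_Cst u = fps_Cst v \<longleftrightarrow> u = v"
  by (simp add: fps_eq_iff)

lemma fps_Cst_power: "fps_Cst (u ^ k) = fps_Cst u ^ k"
proof (induction k)
  case 0
  then show ?case
    by (simp add: fps_eq_iff)
next
  case (Suc k)
  have "fps_Cst (u * u ^ k) = fps_Cst u * fps_Cst (u ^ k)"
    by (simp add: fps_eq_iff fps_mult_nth Cst_sum Cst_mult)
  with Suc show ?case
    by simp
qed

lemma fps_Cst_compose: "fps_Cst (u oo v) = fps_Cst u oo fps_Cst v"
  by (simp add: fps_eq_iff fps_compose_nth Cst_sum Cst_mult flip: fps_Cst_power)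

text \<open>The induction on \<open>k\<close> passes from \<open>m\<close> to \<open>Suc m\<close>;
  the case of interest is \<open>m = 0\<close>, Taylor's formula.\<close>

lemma fact_mult_deriv_nth:
  fixes u :: "'a::field_char_0 fps"
  shows "fact m * fps_nth ((fps_deriv ^^ k) u) m = fact (m + k) * fps_nth u (m + k)"
proof (induction k arbitrary: m)
  case (Suc k)
  then show ?case
    using Suc[of "Suc m"] by (simp add: mult_ac)
qed simp

lemma Phi_eq: "Phi n u = (\<Sum>k=0..n. Cst (fact k * fps_nth u k) * bell n k)"
  using fact_mult_deriv_nth[of 0 _ u] by (simp add: Phi_def)

lemma subst_Phi: "subst (Phi n u) H = (\<Sum>k=0..n. Cst (fact k * fps_nth u k) * bell_at n k H)"
  by (simp add: Phi_eq subst_sum subst_bell)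

text \<open>The factor \<open>k!\<close> of the \<open>k\<close>-th derivative at 0 cancels the
  \<open>1/k!\<close> in \<open>egf_power_nth\<close>.\<close>

lemma sum_bell_at_eq_compose:
  "Cst (1 / fact n) * (\<Sum>k=0..n. Cst (fact k * fps_nth u k) * bell_at n k H) =
    fps_nth (fps_Cst u oo egf H) n"
proof -
  have "Cst (1 / fact n) * (Cst (fact k * fps_nth u k) * bell_at n k H) =
      Cst (fps_nth u k) * fps_nth (egf H ^ k) n" for k
  proof -
    have "Cst (1 / fact n) * (Cst (fact k * fps_nth u k) * bell_at n k H) =
        Cst (fact k * fps_nth u k) * (Cst (1 / fact k) * fps_nth (egf H ^ k) n)"
      by (simp only: egf_power_nth mult_ac)
    also have "\<dots> = Cst (fact k * fps_nth u k * (1 / fact k)) * fps_nth (egf H ^ k) n"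
      by (simp only: Cst_mult mult.assoc)
    finally show ?thesis
      by simp
  qed
  then show ?thesis
    by (simp add: fps_compose_nth sum_distrib_left)
qed

lemma Phi_gf: "Cst (1 / fact n) * Phi n u = fps_nth (fps_Cst u oo egf X) n"
  by (simp only: Phi_eq bell_eq_bell_at sum_bell_at_eq_compose)

lemma subst_Phi_gf: "Cst (1 / fact n) * subst (Phi n u) H = fps_nth (fps_Cst u oo egf H) n"
  by (simp only: subst_Phi sum_bell_at_eq_compose)

lemma Cst_mult_cancel:
  fixes P Q :: "'a::field lpoly"
  assumes "c \<noteq> 0" "Cst c * P = Cst c * Q"
  shows "P = Q"
proof -
  have "Cst (inverse c) * (Cst c * P) = Cst (inverse c) * (Cst c * Q)"
    by (simp only: assms(2))
  with assms(1) show ?thesis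
    by (simp add: mult.assoc[symmetric] flip: Cst_mult)
qed

text \<open>Reduces both cases of the theorem to computing \<open>Phi n\<close> of a
  composition.\<close>

lemma Phi_inject: "(\<forall>n. Phi n u = Phi n v) \<longleftrightarrow> u = v"
proof
  assume "\<forall>n. Phi n u = Phi n v"
  then have "fps_Cst u oo egf X = fps_Cst v oo egf X"
    by (metis Phi_gf fps_ext)
  moreover have "fps_nth (egf X) 0 = (0 :: 'a lpoly)" "fps_nth (egf X) 1 \<noteq> (0 :: 'a lpoly)"
    by (simp_all add: egf_def X_neq_0)
  ultimately show "u = v"
    by (simp add: fps_compose_inj_right fps_Cst_eq_iff)
qed simp

lemma subst_Phi_compose:
  assumes "fps_nth g 0 = 0"
  shows "subst (Phi n f) (\<lambda>j. Phi j g) = Phi n (f oo g)"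
proof -
  \<comment> \<open>In degree 0 the left side is 0 by definition and the right side is
    \<open>g(0)\<close>, which vanishes by assumption.\<close>
  have "egf (\<lambda>j. Phi j g) = fps_Cst g oo egf X"
  proof (rule fps_ext)
    fix m
    show "fps_nth (egf (\<lambda>j. Phi j g)) m = fps_nth (fps_Cst g oo egf X) m"
      using Phi_gf[of m g] assms by (cases "m = 0") (simp_all add: egf_def)
  qed
  then have "fps_Cst f oo egf (\<lambda>j. Phi j g) = fps_Cst (f oo g) oo egf X"
    using assms by (simp add: fps_Cst_compose fps_compose_assoc egf_def)
  then have "Cst (1 / fact n) * subst (Phi n f) (\<lambda>j. Phi j g) = Cst (1 / fact n) * Phi n (f oo g)"
    by (simp only: subst_Phi_gf Phi_gf)
  then show ?thesis
    by (rule Cst_mult_cancel[rotated]) simp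
qed

lemma Phi_0_left: "Phi 0 u = Cst (fps_nth u 0)"
  by (simp add: Phi_def bell_def)

text \<open>A constant affects only the term \<open>k = 0\<close>, and \<open>bell n 0 = 0\<close>
  for positive \<open>n\<close>.\<close>

lemma Phi_minus_const:
  assumes "n \<ge> 1"
  shows "Phi n (u - fps_const a) = Phi n u"
  unfolding Phi_eq
proof (rule sum.cong)
  fix k
  show "Cst (fact k * fps_nth (u - fps_const a) k) * bell n k = Cst (fact k * fps_nth u k) * bell n k"
    using assms by (cases "k = 0") (simp_all add: bell_def)
qed simp

section \<open>Laurent polynomials\<close>

lemma fps_powi_nth_0: "fps_nth (b powi i) 0 = (fps_nth b 0 :: 'a::field) powi i"
  by (simp add: power_int_def fps_power_zeroth)

lemma fps_powi_compose:
  fixes b c :: "'a::field fps"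
  assumes "fps_nth b 0 \<noteq> 0" "fps_nth c 0 = 0"
  shows "b powi i oo c = (b oo c) powi i"
  using assms by (simp add: power_int_def fps_compose_power[symmetric] fps_inverse_compose)

lemma fps_deriv_powi:
  fixes b :: "'a::field fps"
  assumes "fps_nth b 0 \<noteq> 0"
  shows "fps_deriv (b powi i) = of_int i * b powi (i - 1) * fps_deriv b"
proof (cases "i \<ge> 1")
  case True
  define n where "n = nat (i - 1)"
  have i: "i = int (Suc n)"
    using True by (simp add: n_def)
  have "b powi i = b ^ Suc n" "b powi (i - 1) = b ^ n" "of_int i = (of_nat (Suc n) :: 'a fps)"
    by (simp_all add: i power_int_def nat_add_distrib)
  then show ?thesis
    by (simp only: fps_deriv_power' diff_Suc_1 mult_ac)
next
  case False
  define n where "n = nat (- i)"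
  have i: "i = - int n"
    using False by (simp add: n_def)
  show ?thesis
  proof (cases n)
    case 0
    then show ?thesis
      by (simp add: i)
  next
    case (Suc m)
    \<comment> \<open>Two factors \<open>inverse b\<close> are split off to match
      \<open>- b' * (inverse b)^2\<close>, the derivative of \<open>inverse b\<close>.\<close>
    have "b powi i = inverse b ^ Suc m" "b powi (i - 1) = inverse b ^ m * (inverse b)\<^sup>2"
        "of_int i = (- of_nat (Suc m) :: 'a fps)"
      using Suc by (simp_all add: i power_int_def nat_add_distrib power2_eq_square mult_ac)
    then show ?thesis
      by (simp only: fps_deriv_power' fps_inverse_deriv[OF assms] diff_Suc_1
          mult_minus_left mult_minus_right mult_ac)
  qed
qed

lemma fls_deriv_support_subset:
  fixes f :: "'a::ring_1 fls"
  shows "{i. fls_nth (fls_deriv f) i \<noteq> 0} \<subseteq> (\<lambda>i. i - 1) ` {i. fls_nth f i \<noteq> 0}"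
  by (auto simp: image_iff) (metis add_diff_cancel_right' mult_zero_right)

lemma laurent_polys_deriv:
  fixes f :: "'a::ring_1 fls"
  assumes "f \<in> laurent_polys"
  shows "fls_deriv f \<in> laurent_polys"
  using assms finite_subset[OF fls_deriv_support_subset[of f]]
  by (simp add: laurent_polys_def del: fls_deriv_nth)

lemma laurent_compose_superset:
  assumes "finite A" "{i. fls_nth f i \<noteq> 0} \<subseteq> A"
  shows "laurent_compose f g = (\<Sum>i\<in>A. fps_const (fls_nth f i) * g powi i)"
  unfolding laurent_compose_def by (rule sum.mono_neutral_left) (use assms in auto)

lemma fps_deriv_laurent_compose:
  fixes f :: "'a::field fls"
  assumes "f \<in> laurent_polys" "fps_nth g 0 \<noteq> 0"
  shows "fps_deriv (laurent_compose f g) = laurent_compose (fls_deriv f) g * fps_deriv g"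
proof -
  let ?S = "{i. fls_nth f i \<noteq> 0}"
  have S: "finite ?S"
    using assms(1) by (simp add: laurent_polys_def)
  \<comment> \<open>The support of the derivative is enlarged to the shifted support of
    \<open>f\<close>, so both sides of the chain rule are sums over \<open>?S\<close>.\<close>
  have "laurent_compose (fls_deriv f) g =
      (\<Sum>i\<in>(\<lambda>i. i - 1) ` ?S. fps_const (fls_nth (fls_deriv f) i) * g powi i)"
    using S by (intro laurent_compose_superset fls_deriv_support_subset) auto
  also have "\<dots> = (\<Sum>i\<in>?S. fps_const (of_int i * fls_nth f i) * g powi (i - 1))"
    by (subst sum.reindex) (auto simp: inj_on_def)
  finally have "laurent_compose (fls_deriv f) g * fps_deriv g =
      (\<Sum>i\<in>?S. fps_const (of_int i * fls_nth f i) * g powi (i - 1) * fps_deriv g)"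
    by (simp only: sum_distrib_right)
  also have "\<dots> = fps_deriv (laurent_compose f g)"
    unfolding laurent_compose_def fps_deriv_sum
    by (rule sum.cong)
       (simp_all add: fps_deriv_powi assms fps_of_int mult_ac flip: fps_const_mult)
  finally show ?thesis
    by simp
qed

lemma laurent_compose_compose:
  fixes f :: "'a::field fls"
  assumes "fps_nth b 0 \<noteq> 0" "fps_nth c 0 = 0"
  shows "laurent_compose f b oo c = laurent_compose f (b oo c)"
  using assms
  by (simp add: laurent_compose_def fps_compose_sum_distrib fps_compose_mult_distrib fps_powi_compose)

text \<open>The expansion \<open>f(a + x)\<close>; for nonzero \<open>a\<close> the inner series is
  a unit.\<close>

definition taylor :: "'a::field fls \<Rightarrow> 'a \<Rightarrow> 'a fps" where
  "taylor f a = laurent_compose f (fps_const a + fps_X)"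

lemma taylor_compose:
  assumes "fps_nth g 0 \<noteq> 0"
  shows "taylor f (fps_nth g 0) oo (g - fps_const (fps_nth g 0)) = laurent_compose f g"
proof -
  have "(fps_const (fps_nth g 0) + fps_X) oo (g - fps_const (fps_nth g 0)) = g"
    by (simp add: fps_compose_add_distrib fps_X_fps_compose fps_eq_iff)
  with assms show ?thesis
    by (simp add: taylor_def laurent_compose_compose)
qed

text \<open>The chain rule, iterated; the inner series \<open>a + x\<close> has derivative
  1.\<close>

lemma funpow_deriv_taylor:
  assumes "f \<in> laurent_polys" "a \<noteq> 0"
  shows "(fps_deriv ^^ k) (taylor f a) = taylor ((fls_deriv ^^ k) f) a"
proof -
  have "(fls_deriv ^^ k) f \<in> laurent_polys" for k
    by (induction k) (simp_all add: assms laurent_polys_deriv)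
  then show ?thesis
    using assms(2) by (induction k) (simp_all add: taylor_def fps_deriv_laurent_compose)
qed

lemma taylor_nth_0: "fps_nth (taylor f a) 0 = (\<Sum>i | fls_nth f i \<noteq> 0. fls_nth f i * a powi i)"
  by (simp add: taylor_def laurent_compose_def fps_sum_nth fps_powi_nth_0)

text \<open>Putting \<open>X 0 = a\<close> turns each coefficient \<open>D^k(f)(X 0)\<close> into
  \<open>D^k(f)(a)\<close>, the \<open>k\<close>-th derivative of the Taylor series at 0.\<close>

lemma subst_Phi_laurent:
  assumes f: "f \<in> laurent_polys" and a: "a \<noteq> 0" and H: "H 0 = Cst a"
  shows "subst (Phi_laurent n f) H = subst (Phi n (taylor f a)) H"
proof -
  have "subst (eval_X0 q * bell n k) H = Cst (fps_nth (taylor q a) 0) * bell_at n k H" for q k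
    by (simp add: eval_X0_def sum_distrib_right subst_sum subst_X0_bell H unit_powi_Cst[OF a]
        taylor_nth_0 Cst_sum Cst_mult)
  then show ?thesis
    by (simp add: Phi_laurent_def Phi_def subst_sum subst_bell funpow_deriv_taylor[OF f a])
qed

lemma subst_Phi_laurent_compose:
  assumes f: "f \<in> laurent_polys" and g: "fps_nth g 0 \<noteq> 0"
  shows "subst (Phi_laurent n f) (\<lambda>j. Phi j g) = Phi n (laurent_compose f g)"
proof -
  let ?a = "fps_nth g 0"
  have "subst (Phi_laurent n f) (\<lambda>j. Phi j g) = subst (Phi n (taylor f ?a)) (\<lambda>j. Phi j g)"
    by (rule subst_Phi_laurent[OF f g]) (rule Phi_0_left)
  \<comment> \<open>Subtracting \<open>g(0)\<close> changes only \<open>Phi 0 g\<close>, and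
    \<open>bell_at\<close> reads \<open>H\<close> at positive indices only.\<close>
  also have "\<dots> = subst (Phi n (taylor f ?a)) (\<lambda>j. Phi j (g - fps_const ?a))"
    unfolding subst_Phi
    by (intro sum.cong refl arg_cong2[where f = "(*)"] bell_at_cong) (simp add: Phi_minus_const)
  also have "\<dots> = Phi n (laurent_compose f g)"
    by (simp add: subst_Phi_compose taylor_compose[OF g])
  finally show ?thesis .
qed

theorem theorem4p11:
  fixes g h :: "'a::field_char_0 fps"
  shows "(\<forall>f :: 'a fps. fps_nth g 0 = 0 \<longrightarrow>
            (h = f oo g \<longleftrightarrow> (\<forall>n. Phi n h = subst (Phi n f) (\<lambda>j. Phi j g)))) \<and>
         (\<forall>f \<in> (laurent_polys :: 'a fls set). fps_nth g 0 \<noteq> 0 \<longrightarrow>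
            (h = laurent_compose f g \<longleftrightarrow>
              (\<forall>n. Phi n h = subst (Phi_laurent n f) (\<lambda>j. Phi j g))))"
  by (simp add: subst_Phi_compose subst_Phi_laurent_compose Phi_inject)

end
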